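(* Let $\tau$ be a finite unary vocabulary, $t = 2^{|\tau|}$, and $\mathfrak{M}$ a $\tau$-model of size $n$. Then \[ H_S(\mathfrak{M}) - \frac{1}{n}H_B(\mathfrak{M}) < \frac{(t-1)\log(\sqrt{2\pi n})}{n} - \frac{\log(e)}{12n^2} + \frac{t\log(e)}{12n^2+n}. \]
   Context: All logarithms are base 2. A $\tau$-model of size $n$ has domain $\{1,\dots,n\}$ and interprets each unary symbol as a subset. The $t$ $\tau$-types are the subsets $\pi_1,\dots,\pi_t$ of $\tau$; $n_i=|\pi_i|$ is the number of points lying in exactly the relations named in $\pi_i$. Shannon entropy: $H_S(\mathfrak{M}) = \sum_{i=1}^t -\frac{n_i}{n}\log\frac{n_i}{n}$ (with $0\log 0=0$). Boltzmann entropy: $H_B(\mathfrak{M}) = \log|\mathcal{M}|$ where $\mathcal{M}$ is the isomorphism class of $\mathfrak{M}$ among $\tau$-models with domain $\{1,\dots,n\}$, i.e. $H_B(\mathfrak{M}) = \log\frac{n!}{n_1!\cdots n_t!}$.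
   Formalization: The vocabulary τ is assumed nonempty (so t ≥ 2); for empty τ the claim fails for every n, since the left side is 0 while the right side, log(e)/(12n²+n) − log(e)/(12n²), is negative. *)

theory Defs
  imports Complex_Main "HOL-Library.FuncSet"
begin

text \<open>
  A unary vocabulary is a nonempty finite set of relation symbols. A model of size \<open>n\<close> assigns to each symbol
  a subset of \<open>{1..n}\<close>. Models are extensional functions, so that two models agreeing on the
  vocabulary are equal and cardinalities of sets of models count each model once.
\<close>

definition models :: "'p set \<Rightarrow> nat \<Rightarrow> ('p \<Rightarrow> nat set) set" where
  "models \<tau> n = (\<Pi>\<^sub>E P\<in>\<tau>. Pow {1..n})"

definition types :: "'p set \<Rightarrow> 'p set set" where
  "types \<tau> = Pow \<tau>"

definition realization :: "'p set \<Rightarrow> nat \<Rightarrow> ('p \<Rightarrow> nat set) \<Rightarrow> 'p set \<Rightarrow> nat set" where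
  "realization \<tau> n M \<pi> = {x \<in> {1..n}. \<forall>P\<in>\<tau>. x \<in> M P \<longleftrightarrow> P \<in> \<pi>}"

definition isomorphic :: "'p set \<Rightarrow> nat \<Rightarrow> ('p \<Rightarrow> nat set) \<Rightarrow> ('p \<Rightarrow> nat set) \<Rightarrow> bool" where
  "isomorphic \<tau> n M N \<longleftrightarrow>
     (\<exists>f. bij_betw f {1..n} {1..n} \<and> (\<forall>P\<in>\<tau>. \<forall>x\<in>{1..n}. x \<in> M P \<longleftrightarrow> f x \<in> N P))"

definition iso_class :: "'p set \<Rightarrow> nat \<Rightarrow> ('p \<Rightarrow> nat set) \<Rightarrow> ('p \<Rightarrow> nat set) set" where
  "iso_class \<tau> n M = {N \<in> models \<tau> n. isomorphic \<tau> n M N}"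

text \<open>For an unrealized type the summand is \<open>0 * log 2 0 = 0\<close>, as the convention requires.\<close>

definition shannon_entropy :: "'p set \<Rightarrow> nat \<Rightarrow> ('p \<Rightarrow> nat set) \<Rightarrow> real" where
  "shannon_entropy \<tau> n M =
     (\<Sum>\<pi>\<in>types \<tau>. - (real (card (realization \<tau> n M \<pi>)) / real n)
                    * log 2 (real (card (realization \<tau> n M \<pi>)) / real n))"

definition boltzmann_entropy :: "'p set \<Rightarrow> nat \<Rightarrow> ('p \<Rightarrow> nat set) \<Rightarrow> real" where
  "boltzmann_entropy \<tau> n M = log 2 (real (card (iso_class \<tau> n M)))"

end

theory Submission
  imports Defs "HOL-Analysis.Harmonic_Numbers" "HOL-Combinatorics.Multiset_Permutations"
    "HOL-Combinatorics.List_Permutation"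
begin

text \<open>
  Put \<open>g m = ln m! - m ln m + m\<close>. Up to the factor \<open>n ln 2\<close> the difference of the entropies is
  \<open>\<Sum> g n\<^sub>i - g n\<close>, where \<open>n\<^sub>i\<close> are the sizes of the realizations. As \<open>g\<close> is monotone, the largest
  \<open>n\<^sub>i\<close> contributes at most \<open>g n\<close>. Each other \<open>n\<^sub>i\<close> is at most \<open>n / 2\<close>, so the elementary bound
  \<open>g m \<le> 1 + (ln m) / 2\<close> together with \<open>e\<^sup>2 \<le> 4 \<pi>\<close> gives \<open>g n\<^sub>i \<le> ln (sqrt (2 \<pi> n))\<close>. What remains
  of the claimed bound, \<open>t / (12 n + 1) - 1 / (12 n)\<close>, is positive because \<open>t \<ge> 2\<close>; in particular
  the exact constant in Stirling's formula is not needed.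
\<close>

section \<open>Growth of the logarithm of the factorial\<close>

definition ln_fact_excess :: "nat \<Rightarrow> real" where
  "ln_fact_excess m = ln (fact m) - real m * ln (real m) + real m"

lemma ln_fact_excess_0 [simp]: "ln_fact_excess 0 = 0"
  by (simp add: ln_fact_excess_def)

lemma ln_fact_excess_Suc:
  assumes "m > 0"
  shows "ln_fact_excess (Suc m) = ln_fact_excess m + 1 - real m * (ln (real (Suc m)) - ln (real m))"
proof -
  have "ln (fact (Suc m) :: real) = ln (real (Suc m)) + ln (fact m)"
    by (simp add: ln_mult del: of_nat_Suc)
  then show ?thesis
    by (simp add: ln_fact_excess_def algebra_simps)
qed

text \<open>For positive m the increment is \<open>1 - m * ln (1 + 1 / m)\<close>, which is
  nonnegative since \<open>ln (1 + x) \<le> x\<close>.\<close>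

lemma mono_ln_fact_excess: "mono ln_fact_excess"
proof (rule mono_iff_le_Suc[THEN iffD2], rule allI)
  fix m :: nat
  show "ln_fact_excess m \<le> ln_fact_excess (Suc m)"
  proof (cases "m = 0")
    case True
    then show ?thesis by (simp add: ln_fact_excess_def)
  next
    case False
    then have "ln (real (Suc m)) - ln (real m) \<le> 1 / real m"
      using ln_diff_le[of "real (Suc m)" "real m"] by simp
    then have "real m * (ln (real (Suc m)) - ln (real m)) \<le> 1"
      using False by (simp add: field_simps)
    then show ?thesis using False ln_fact_excess_Suc[of m] by simp
  qed
qed

text \<open>Each increment is at most half of \<open>ln (m + 1) - ln m\<close>, because the integral
  of 1 / x over [m, m + 1] is at least the midpoint value \<open>2 / (2 * m + 1)\<close>.\<close>

lemma ln_fact_excess_le: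
  assumes "m > 0"
  shows "ln_fact_excess m \<le> 1 + ln (real m) / 2"
  using assms
proof (induction m rule: nat_induct_non_zero)
  case 1
  show ?case by (simp add: ln_fact_excess_def)
next
  case (Suc m)
  define d where "d = ln (real (Suc m)) - ln (real m)"
  have "d \<ge> 2 / (2 * real m + 1)"
    using ln_inverse_approx_ge[of "real m" "real (Suc m)"] Suc.hyps
    by (simp add: d_def algebra_simps)
  then have "1 \<le> real m * d + d / 2"
    by (simp add: field_simps)
  then show ?case
    using Suc.IH Suc.hyps unfolding ln_fact_excess_Suc[OF Suc.hyps] d_def by (simp add: field_simps)
qed

text \<open>For positive m the bound \<open>1 + ln m / 2\<close> is half of
  \<open>ln (exp 2 * m)\<close>, so it suffices that \<open>exp 2 * m \<le> 2 * pi * n\<close>; this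
  follows from \<open>exp 2 \<le> 4 * pi\<close> and \<open>2 * m \<le> n\<close>.\<close>

lemma ln_fact_excess_half_le:
  assumes "n > 0" and "2 * m \<le> n"
  shows "ln_fact_excess m \<le> ln (sqrt (2 * pi * real n))"
proof -
  have sqrt: "ln (sqrt (2 * pi * real n)) = ln (2 * pi * real n) / 2"
    using assms by (intro ln_sqrt) simp
  show ?thesis
  proof (cases "m = 0")
    case True
    \<comment> \<open>The excess at 0 is 0, so only nonnegativity of the right side is at
      stake.\<close>
    have "1 * 1 \<le> (2 * pi) * real n"
      using assms pi_ge_two by (intro mult_mono) auto
    then have "ln (2 * pi * real n) \<ge> 0" by simp
    then show ?thesis using True sqrt by simp
  next
    case False
    have "exp 2 = exp 1 * exp (1::real)" by (simp flip: exp_add)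
    also have "\<dots> \<le> 3 * 3" by (intro mult_mono exp_le) auto
    also have "\<dots> \<le> 4 * pi" using pi_approx by simp
    finally have "exp 2 * real m \<le> 4 * pi * real m"
      using False by (intro mult_right_mono) auto
    also have "\<dots> \<le> 2 * pi * real n"
      using assms(2) by (simp flip: of_nat_le_iff[where 'a = real])
    finally have "ln (exp 2 * real m) \<le> ln (2 * pi * real n)"
      using False assms(1) by simp
    then have "2 + ln (real m) \<le> ln (2 * pi * real n)"
      using False by (simp add: ln_mult)
    then show ?thesis using sqrt ln_fact_excess_le[of m] False by simp
  qed
qed

lemma sum_ln_fact_excess_le:
  fixes r :: "'a \<Rightarrow> nat"
  assumes "finite I" and "I \<noteq> {}" and sum: "(\<Sum>i\<in>I. r i) = n" and "n > 0"
  shows "(\<Sum>i\<in>I. ln_fact_excess (r i)) - ln_fact_excess n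
           \<le> (real (card I) - 1) * ln (sqrt (2 * pi * real n))"
proof -
  obtain k where k: "k \<in> I" and max: "\<And>i. i \<in> I \<Longrightarrow> r i \<le> r k"
    using obtains_MAX[OF assms(1,2), of r] assms(1) by (metis Max_ge finite_imageI image_eqI)
  \<comment> \<open>Polymorphic in \<open>f\<close>, to serve both the sum of the sizes and the sum
    of the excesses.\<close>
  have split: "(\<Sum>i\<in>I. f (r i)) = f (r k) + (\<Sum>i\<in>I - {k}. f (r i))" for f :: "nat \<Rightarrow> 'b::comm_monoid_add"
    using assms(1) k by (rule sum.remove)
  have rk: "r k \<le> n" using split[of "\<lambda>x. x"] sum by simp
  have "(\<Sum>i\<in>I - {k}. ln_fact_excess (r i)) \<le> real (card (I - {k})) * ln (sqrt (2 * pi * real n))"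
  proof (rule sum_bounded_above)
    fix i assume i: "i \<in> I - {k}"
    \<comment> \<open>The sum without \<open>k\<close> is \<open>n - r k\<close>, so
      \<open>r i + r k \<le> n\<close>; with \<open>r i \<le> r k\<close> this gives
      \<open>2 * r i \<le> n\<close>.\<close>
    have "r i \<le> (\<Sum>i\<in>I - {k}. r i)"
      using i assms(1) by (intro member_le_sum) auto
    then have "2 * r i \<le> n" using split[of "\<lambda>x. x"] sum max[of i] i by simp
    then show "ln_fact_excess (r i) \<le> ln (sqrt (2 * pi * real n))"
      using \<open>n > 0\<close> by (intro ln_fact_excess_half_le)
  qed
  moreover have "real (card (I - {k})) = real (card I) - 1"
    using k assms(1,2) by (simp add: card_Diff_singleton card_gt_0_iff Suc_leI of_nat_diff)
  ultimately show ?thesis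
    using split[of ln_fact_excess] monoD[OF mono_ln_fact_excess rk] by simp
qed

section \<open>Models encoded as lists of types\<close>

definition point_types :: "'p set \<Rightarrow> nat \<Rightarrow> ('p \<Rightarrow> nat set) \<Rightarrow> 'p set list" where
  "point_types \<tau> n M = map (\<lambda>x. {P \<in> \<tau>. x \<in> M P}) [1..<Suc n]"

text \<open>Decodes a list of types: position i describes the point i + 1, hence the shift.
  Restricting to \<open>\<tau>\<close> yields an extensional function, as membership in
  \<open>models\<close> demands.\<close>

definition model_of :: "'p set \<Rightarrow> nat \<Rightarrow> 'p set list \<Rightarrow> 'p \<Rightarrow> nat set" where
  "model_of \<tau> n xs = (\<lambda>P\<in>\<tau>. {x \<in> {1..n}. P \<in> xs ! (x - 1)})"

lemma length_point_types [simp]: "length (point_types \<tau> n M) = n"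
  by (simp add: point_types_def)

lemma nth_point_types: "i < n \<Longrightarrow> point_types \<tau> n M ! i = {P \<in> \<tau>. Suc i \<in> M P}"
  by (simp add: point_types_def del: upt_Suc)

lemma set_point_types: "set (point_types \<tau> n M) \<subseteq> types \<tau>"
  by (auto simp: point_types_def types_def)

text \<open>Recovering the list makes decoding injective on lists of length n over the types, so
  counting such lists bounds a number of models from below.\<close>

lemma point_types_model_of:
  assumes "length xs = n" and "set xs \<subseteq> types \<tau>"
  shows "point_types \<tau> n (model_of \<tau> n xs) = xs"
proof (rule nth_equalityI)
  fix i assume "i < length (point_types \<tau> n (model_of \<tau> n xs))"
  then have i: "i < n" by simp
  then have "xs ! i \<in> types \<tau>"
    using assms nth_mem[of i xs] by blast
  then have "xs ! i \<subseteq> \<tau>" by (simp add: types_def)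
  then show "point_types \<tau> n (model_of \<tau> n xs) ! i = xs ! i"
    using i by (auto simp: nth_point_types model_of_def)
qed (simp add: assms)

text \<open>The shift \<open>Suc\<close> carries the list positions holding \<open>\<pi>\<close> to
  the points realizing \<open>\<pi>\<close>.\<close>

lemma count_point_types:
  assumes "\<pi> \<in> types \<tau>"
  shows "count (mset (point_types \<tau> n M)) \<pi> = card (realization \<tau> n M \<pi>)"
proof -
  have "{P \<in> \<tau>. x \<in> M P} = \<pi> \<longleftrightarrow> (\<forall>P\<in>\<tau>. x \<in> M P \<longleftrightarrow> P \<in> \<pi>)" for x
    using assms unfolding types_def by blast
  then have eq: "{i. i < n \<and> \<pi> = point_types \<tau> n M ! i} = {i. i < n \<and> Suc i \<in> realization \<tau> n M \<pi>}"
    by (simp add: nth_point_types realization_def eq_commute[of \<pi>] cong: conj_cong)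
  have bij: "bij_betw Suc {i. i < n \<and> Suc i \<in> R} R" if "R \<subseteq> {1..n}" for R
    by (rule bij_betwI[where g = "\<lambda>x. x - 1"]) (use that in force)+
  have "realization \<tau> n M \<pi> \<subseteq> {1..n}"
    unfolding realization_def by blast
  then have "card {i. i < n \<and> Suc i \<in> realization \<tau> n M \<pi>} = card (realization \<tau> n M \<pi>)"
    by (intro bij_betw_same_card[OF bij])
  then show ?thesis
    by (simp only: count_mset count_list_eq_length_filter length_filter_conv_card length_point_types eq)
qed

text \<open>Equal multisets give a permutation of the positions that matches the two lists;
  conjugated by the shift, it is a permutation of the points preserving every relation.\<close>

lemma isomorphic_if_mset_point_types_eq:
  assumes "mset (point_types \<tau> n M) = mset (point_types \<tau> n N)"
  shows "isomorphic \<tau> n M N"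
proof -
  obtain f where f: "bij_betw f {..<n} {..<n}"
    and eq: "\<And>i. i < n \<Longrightarrow> point_types \<tau> n M ! i = point_types \<tau> n N ! f i"
    using permutation_Ex_bij[OF assms] by auto
  define h where "h = Suc \<circ> f \<circ> (\<lambda>x. x - 1)"
  have "bij_betw (\<lambda>x. x - 1) {1..n} {..<n}"
    by (rule bij_betwI[where g = Suc]) auto
  moreover have "bij_betw Suc {..<n} {1..n}"
    by (rule bij_betwI[where g = "\<lambda>x. x - 1"]) auto
  ultimately have "bij_betw h {1..n} {1..n}"
    unfolding h_def using f by (blast intro: bij_betw_trans)
  moreover have "x \<in> M P \<longleftrightarrow> h x \<in> N P" if "P \<in> \<tau>" "x \<in> {1..n}" for P x
  proof -
    have x: "x - 1 < n" using that by auto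
    then have "f (x - 1) < n" using f by (auto simp: bij_betw_def)
    then show ?thesis
      using eq[OF x] x that by (auto simp: nth_point_types h_def)
  qed
  ultimately show ?thesis unfolding isomorphic_def by blast
qed

section \<open>Counting the isomorphism class\<close>

lemma finite_models:
  assumes "finite \<tau>"
  shows "finite (models \<tau> n)"
  unfolding models_def using assms by (intro finite_PiE) auto

lemma sum_card_realization:
  assumes "finite \<tau>"
  shows "(\<Sum>\<pi>\<in>types \<tau>. card (realization \<tau> n M \<pi>)) = n"
proof -
  have "(\<Sum>\<pi>\<in>types \<tau>. card (realization \<tau> n M \<pi>))
      = (\<Sum>\<pi>\<in>types \<tau>. count (mset (point_types \<tau> n M)) \<pi>)"
    by (simp add: count_point_types)
  also have "\<dots> = size (mset (point_types \<tau> n M))"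
    unfolding size_multiset_overloaded_eq
    using assms set_point_types[of \<tau> n M]
    by (intro sum.mono_neutral_right) (auto simp: types_def simp flip: count_greater_zero_iff)
  finally show ?thesis by simp
qed

text \<open>Rearrangements of the list of point types decode to models isomorphic to
  \<open>M\<close>, distinct ones to distinct models, and their number is the multinomial
  coefficient. A lower bound on the class is wanted because the Boltzmann entropy is
  subtracted.\<close>

lemma fact_le_card_iso_class:
  assumes "finite \<tau>"
  shows "fact n \<le> card (iso_class \<tau> n M) * (\<Prod>\<pi>\<in>types \<tau>. fact (card (realization \<tau> n M \<pi>)))"
proof -
  let ?A = "mset (point_types \<tau> n M)"
  have list: "length xs = n" "set xs \<subseteq> types \<tau>" "mset xs = ?A"
    if "xs \<in> permutations_of_multiset ?A" for xs
  proof -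
    show m: "mset xs = ?A" using that by (rule permutations_of_multisetD)
    show "length xs = n" using mset_eq_length[OF m] by simp
    show "set xs \<subseteq> types \<tau>" using mset_eq_setD[OF m] set_point_types by simp
  qed
  have "inj_on (model_of \<tau> n) (permutations_of_multiset ?A)"
    by (rule inj_on_inverseI[where g = "point_types \<tau> n"]) (simp add: point_types_model_of list)
  moreover have "model_of \<tau> n ` permutations_of_multiset ?A \<subseteq> iso_class \<tau> n M"
  proof safe
    fix xs assume "xs \<in> permutations_of_multiset ?A"
    note xs = list[OF this]
    have "isomorphic \<tau> n M (model_of \<tau> n xs)"
      by (rule isomorphic_if_mset_point_types_eq) (simp add: point_types_model_of xs)
    moreover have "model_of \<tau> n xs \<in> models \<tau> n"
      by (auto simp: model_of_def models_def)
    ultimately show "model_of \<tau> n xs \<in> iso_class \<tau> n M"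
      by (simp add: iso_class_def)
  qed
  moreover have "finite (iso_class \<tau> n M)"
    using finite_models[OF assms] by (simp add: iso_class_def)
  ultimately have le: "card (permutations_of_multiset ?A) \<le> card (iso_class \<tau> n M)"
    by (rule card_inj_on_le)
  \<comment> \<open>Unrealized types may join the product, since each contributes 0! = 1.\<close>
  have prod: "(\<Prod>\<pi>\<in>set_mset ?A. fact (count ?A \<pi>) :: nat) = (\<Prod>\<pi>\<in>types \<tau>. fact (count ?A \<pi>))"
  proof (rule prod.mono_neutral_left)
    show "finite (types \<tau>)" using assms by (simp add: types_def)
    show "set_mset ?A \<subseteq> types \<tau>" using set_point_types by simp
    show "\<forall>\<pi>\<in>types \<tau> - set_mset ?A. fact (count ?A \<pi>) = (1::nat)"
      by (metis DiffD2 fact_0 not_in_iff)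
  qed
  have "fact n = card (permutations_of_multiset ?A) * (\<Prod>\<pi>\<in>set_mset ?A. fact (count ?A \<pi>))"
    using card_permutations_of_multiset_aux[of ?A] by (simp only: size_mset length_point_types mult.commute)
  also have "\<dots> \<le> card (iso_class \<tau> n M) * (\<Prod>\<pi>\<in>set_mset ?A. fact (count ?A \<pi>))"
    using le by (rule mult_le_mono1)
  finally show ?thesis
    unfolding prod by (simp add: count_point_types)
qed

section \<open>The two entropies in natural logarithms\<close>

lemma boltzmann_entropy_ge:
  assumes "finite \<tau>"
  shows "ln 2 * boltzmann_entropy \<tau> n M
           \<ge> ln (fact n) - (\<Sum>\<pi>\<in>types \<tau>. ln (fact (card (realization \<tau> n M \<pi>))))"
proof -
  let ?p = "\<Prod>\<pi>\<in>types \<tau>. fact (card (realization \<tau> n M \<pi>)) :: real"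
  have fin: "finite (types \<tau>)" using assms by (simp add: types_def)
  have p: "?p > 0" by (simp add: prod_pos)
  have le: "fact n \<le> real (card (iso_class \<tau> n M)) * ?p"
    using of_nat_mono[OF fact_le_card_iso_class[OF assms, of n M], where 'a = real] by simp
  then have card: "real (card (iso_class \<tau> n M)) > 0"
    using fact_gt_zero[of n, where 'a = real] by (cases "card (iso_class \<tau> n M) = 0") (auto simp del: fact_gt_zero)
  have "ln (fact n) \<le> ln (real (card (iso_class \<tau> n M)) * ?p)"
    using le card p by simp
  also have "\<dots> = ln (real (card (iso_class \<tau> n M))) + ln ?p"
    using card p by (intro ln_mult_pos) auto
  also have "ln ?p = (\<Sum>\<pi>\<in>types \<tau>. ln (fact (card (realization \<tau> n M \<pi>))))"
    using fin by (intro ln_prod) auto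
  finally show ?thesis by (simp add: boltzmann_entropy_def log_def)
qed

lemma shannon_entropy_eq:
  assumes "finite \<tau>" and "n > 0"
  shows "real n * ln 2 * shannon_entropy \<tau> n M = real n * ln (real n)
           - (\<Sum>\<pi>\<in>types \<tau>. real (card (realization \<tau> n M \<pi>)) * ln (real (card (realization \<tau> n M \<pi>))))"
proof -
  let ?r = "\<lambda>\<pi>. real (card (realization \<tau> n M \<pi>))"
  \<comment> \<open>For an unrealized type both sides vanish; otherwise the logarithm of the
    quotient splits.\<close>
  have "real n * ln 2 * (- (?r \<pi> / real n) * log 2 (?r \<pi> / real n)) = ?r \<pi> * ln (real n) - ?r \<pi> * ln (?r \<pi>)"
    for \<pi>
    using \<open>n > 0\<close> by (cases "?r \<pi> = 0") (simp_all add: log_def ln_div field_simps)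
  then have "real n * ln 2 * shannon_entropy \<tau> n M = (\<Sum>\<pi>\<in>types \<tau>. ?r \<pi>) * ln (real n) - (\<Sum>\<pi>\<in>types \<tau>. ?r \<pi> * ln (?r \<pi>))"
    unfolding shannon_entropy_def by (simp add: sum_distrib_left sum_distrib_right sum_subtractf)
  also have "(\<Sum>\<pi>\<in>types \<tau>. ?r \<pi>) = real n"
    by (simp add: sum_card_realization[OF assms(1)] flip: of_nat_sum)
  finally show ?thesis .
qed

theorem theorem6:
  fixes \<tau> :: "'p set" and t n :: nat and M :: "'p \<Rightarrow> nat set"
  assumes "finite \<tau>" and "\<tau> \<noteq> {}"
    and "t = 2 ^ card \<tau>"
    and "n \<ge> 1"
    and "M \<in> models \<tau> n"
  shows "shannon_entropy \<tau> n M - (1 / real n) * boltzmann_entropy \<tau> n M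
       < (real t - 1) * log 2 (sqrt (2 * pi * real n)) / real n
         - log 2 (exp 1) / (12 * (real n)\<^sup>2)
         + real t * log 2 (exp 1) / (12 * (real n)\<^sup>2 + real n)"
proof -
  let ?r = "\<lambda>\<pi>. card (realization \<tau> n M \<pi>)"
  let ?L = "shannon_entropy \<tau> n M - (1 / real n) * boltzmann_entropy \<tau> n M"
  let ?S = "ln (sqrt (2 * pi * real n))"
  have n: "n > 0" using assms(4) by simp
  have types: "finite (types \<tau>)" "types \<tau> \<noteq> {}" "card (types \<tau>) = t"
    using assms(1,3) by (auto simp: types_def card_Pow)
  have sum_r: "(\<Sum>\<pi>\<in>types \<tau>. real (?r \<pi>)) = real n"
    by (simp add: sum_card_realization[OF assms(1)] flip: of_nat_sum)
  have "card \<tau> \<noteq> 0" using assms(1,2) by simp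
  then have "2 ^ 1 \<le> t" unfolding assms(3) by (intro power_increasing) auto
  then have t: "real t \<ge> 2" by simp

  \<comment> \<open>Scaling by \<open>real n * ln 2\<close> clears the division by n and turns
    binary logarithms into natural ones.\<close>
  have "real n * ln 2 * ?L = real n * ln 2 * shannon_entropy \<tau> n M - ln 2 * boltzmann_entropy \<tau> n M"
    using n by (simp add: field_simps)
  \<comment> \<open>The linear terms of the excesses cancel because the sizes of the realizations
    sum to n.\<close>
  also have "\<dots> \<le> (\<Sum>\<pi>\<in>types \<tau>. ln_fact_excess (?r \<pi>)) - ln_fact_excess n"
    using shannon_entropy_eq[OF assms(1) n, of M] boltzmann_entropy_ge[OF assms(1), of n M] sum_r
    by (simp add: ln_fact_excess_def sum.distrib sum_subtractf)
  also have "\<dots> \<le> (real t - 1) * ?S"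
    using sum_ln_fact_excess_le[OF types(1,2) sum_card_realization[OF assms(1)] n] types(3) by simp
  also have "\<dots> < (real t - 1) * ?S - 1 / (12 * real n) + real t / (12 * real n + 1)"
  proof -
    \<comment> \<open>Strictness enters here: 12 n + 1 < 24 n because n \<ge> 1. The next line uses
      t \<ge> 2, which holds as \<open>\<tau>\<close> is nonempty.\<close>
    have "1 / (12 * real n) < 2 / (12 * real n + 1)" using n by (simp add: field_simps)
    also have "\<dots> \<le> real t / (12 * real n + 1)" using t by (intro divide_right_mono) auto
    finally show ?thesis by simp
  qed
  finally have "?L < ((real t - 1) * ?S - 1 / (12 * real n) + real t / (12 * real n + 1)) / (real n * ln 2)"
    using n by (simp add: pos_less_divide_eq mult.commute)
  also have "\<dots> = (real t - 1) * log 2 (sqrt (2 * pi * real n)) / real n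
         - log 2 (exp 1) / (12 * (real n)\<^sup>2)
         + real t * log 2 (exp 1) / (12 * (real n)\<^sup>2 + real n)"
  proof -
    have "12 * (real n)\<^sup>2 + real n = (12 * real n + 1) * real n"
      by (simp add: power2_eq_square algebra_simps)
    then show ?thesis
      by (simp add: log_def power2_eq_square add_divide_distrib diff_divide_distrib mult_ac)
  qed
  finally show ?thesis .
qed

end
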